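(* For every $n\in\mathbb{N}$ there exists $m\in\{2,3,4\}$ such that the ring $\mathbb{M}_n(\mathbb{F}_2)$ is almost $m$-torsion clean. In addition, if $n\in 4+8\mathbb{N}$ (that is, $n=4+8k$ for some $k\in\mathbb{N}$), then $\mathbb{M}_n(\mathbb{F}_2)$ is exactly $4$-torsion clean.
   Context: $\mathbb{N}$ denotes the set of positive integers. $\mathbb{F}_2$ is the field with two elements and $\mathbb{M}_n(\mathbb{F}_2)$ is the ring of all $n\times n$ matrices over $\mathbb{F}_2$. For a positive integer $m$, a ring $R$ with identity $1\neq 0$ is called almost $m$-torsion clean if for every $r\in R$ there exist a unit $u\in R$ with $u^m=1$ and an idempotent $e\in R$ (i.e. $e^2=e$) such that $r=u+e$. The ring $R$ is called $m$-torsion clean if it is almost $m$-torsion clean and $m$ is the smallest positive integer with this property (i.e. $R$ is not almost $m'$-torsion clean for any positive integer $m'<m$). *)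

theory Defs
  imports "Jordan_Normal_Form.Matrix" "HOL-Library.Z2"
begin

definition almost_torsion_clean :: "nat \<Rightarrow> ('a, 'b) ring_scheme \<Rightarrow> bool" where
  "almost_torsion_clean m R \<longleftrightarrow>
     m > 0 \<and> ring R \<and> \<one>\<^bsub>R\<^esub> \<noteq> \<zero>\<^bsub>R\<^esub> \<and>
     (\<forall>r\<in>carrier R. \<exists>u\<in>Units R. \<exists>e\<in>carrier R.
        u [^]\<^bsub>R\<^esub> m = \<one>\<^bsub>R\<^esub> \<and> e \<otimes>\<^bsub>R\<^esub> e = e \<and> r = u \<oplus>\<^bsub>R\<^esub> e)"

definition torsion_clean :: "nat \<Rightarrow> ('a, 'b) ring_scheme \<Rightarrow> bool" where
  "torsion_clean m R \<longleftrightarrow>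
     almost_torsion_clean m R \<and>
     (\<forall>m'. 0 < m' \<and> m' < m \<longrightarrow> \<not> almost_torsion_clean m' R)"

text \<open>The field with two elements is the type \<^typ>\<open>bit\<close>.\<close>

abbreviation mat_ring_F2 :: "nat \<Rightarrow> bit mat ring" where
  "mat_ring_F2 n \<equiv> ring_mat TYPE(bit) n ()"

end

theory Submission
  imports Defs "HOL-Library.Function_Algebras"
begin

text \<open>
  \<^bold>\<open>Every matrix is almost 4-torsion clean.\<close>  In characteristic 2, if \<open>f = q + e\<close> with
  \<open>q\<^sup>4 = 0\<close> and \<open>e\<^sup>2 = e\<close>, then \<open>f = (1 + q) + (1 + e)\<close>, where \<open>(1 + q)\<^sup>4 = 1 + q\<^sup>4 = 1\<close> and
  \<open>1 + e\<close> is idempotent.  So it is enough to split every operator into a nilpotent of index at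
  most 4 and an idempotent.  Splittings can be glued along a direct sum of invariant subspaces,
  so only cyclic operators remain once cyclic direct summands are known to exist.

  Such summands come from a maximality argument that uses no polynomials.  Among all functionals
  \<open>\<phi>\<close> and vectors \<open>v\<close> with \<open>\<phi> (f\<^sup>i v) = 0\<close> for \<open>i < m\<close> and \<open>\<phi> (f\<^sup>m v) = 1\<close>, choose a pair for
  which \<open>m\<close> is maximal and put \<open>d = m + 1\<close>.  The Hankel matrix of the values \<open>\<phi> (f\<^sup>i\<^sup>+\<^sup>j v)\<close>
  with \<open>i, j < d\<close> is anti-triangular with ones on its antidiagonal, so the space is the direct sum
  of the span \<open>C\<close> of the vectors \<open>f\<^sup>i v\<close> with \<open>i < d\<close> and of the common kernel \<open>W\<close> of the
  functionals \<open>\<phi> \<circ> f\<^sup>i\<close> with \<open>i < d\<close>.  A failure of invariance of \<open>W\<close> or of \<open>C\<close> would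
  produce a pair with a larger \<open>m\<close>.  This is \<open>torsion_split_exists\<close>.

  On \<open>C\<close> a basis can be chosen in which the matrix of \<open>f\<close> has ones above the diagonal, any
  prescribed diagonal, and an arbitrary last row; the last row also meets the prescribed diagonal
  exactly when the sum of that diagonal is the trace of \<open>f\<close>.  Pairs of consecutive basis vectors carry
  idempotent blocks with diagonal \<open>(0, 1)\<close>; with up to two single vectors at the bottom they
  realise every trace, and what is left over is nilpotent of index at most 4.  The plane with trace 0 has no
  room for this, but there the square of \<open>f\<close> is 0 or 1.

  \<^bold>\<open>No smaller exponent works if \<open>n = 4 N\<close> with \<open>N\<close> odd.\<close>  Let \<open>r\<close> be multiplication by a root of
  \<open>x\<^sup>4 + x + 1\<close> on an \<open>N\<close>-dimensional space over the field with 16 elements; its cube has trace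
  \<open>N = 1\<close>, while the identity has trace \<open>4 N = 0\<close>.  Besides being invariant under cyclic
  rotation of products, the trace over the field with two elements satisfies \<open>tr (X\<^sup>2) = tr X\<close>.  Expanding the
  traces of the products of a few words in \<open>r\<close> and \<open>e\<close> with the relation \<open>(r + e)\<^sup>3 = 1\<close>
  shows that, for a matrix with \<open>r\<^sup>4 = r + 1\<close>, this relation forces \<open>tr (r\<^sup>3) = tr 1\<close>.  Similarly, \<open>(s + e)\<^sup>2 = 1\<close> forces
  \<open>tr (s\<^sup>5) = tr s\<close>, and this fails for \<open>s = r\<^sup>3\<close>, which has order 5.
\<close>

section \<open>Vectors over the field with two elements\<close>

text \<open>
  Sums and products in \<^typ>\<open>bit\<close> are treated as field operations, not as bitwise ones.
\<close>

declare add_bit_eq_xor [simp del] mult_bit_eq_and [simp del]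

lemma bit_add_self [simp]: "a + a = (0::bit)" "a + (a + b) = (b::bit)"
  by (cases a; cases b; simp add: add.assoc[symmetric])+

lemma vec_add_self [simp]:
  fixes x y :: "'i \<Rightarrow> bit"
  shows "x + x = 0" "x + (x + y) = y"
  by (simp_all add: fun_eq_iff)

lemma vec_add_eq_0_iff: "x + y = 0 \<longleftrightarrow> x = y" for x y :: "'i \<Rightarrow> bit"
  by (metis vec_add_self add.right_neutral)

definition smul :: "bit \<Rightarrow> ('i \<Rightarrow> bit) \<Rightarrow> 'i \<Rightarrow> bit"
  where "smul c x = (if c = 1 then x else 0)"

lemma smul_simps [simp]: "smul 0 x = 0" "smul 1 x = x"
  by (simp_all add: smul_def)

lemma smul_add: "smul (a + b) x = smul a x + smul b x"
  by (cases a; cases b; simp)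

lemma smul_add_right: "smul a (x + y) = smul a x + smul a y"
  by (cases a; simp)

lemma additive_smul:
  assumes "additive f" shows "f (smul c x) = c * f x"
  by (cases c) (simp_all add: additive.zero[OF assms])

text \<open>
  Over the field with two elements the subspaces are the additive subgroups, and the linear maps are
  the additive ones.
\<close>

definition subgrp :: "('i \<Rightarrow> bit) set \<Rightarrow> bool"
  where "subgrp V \<longleftrightarrow> 0 \<in> V \<and> (\<forall>x\<in>V. \<forall>y\<in>V. x + y \<in> V)"

lemma subgrp_smul: "subgrp V \<Longrightarrow> x \<in> V \<Longrightarrow> smul c x \<in> V"
  by (simp add: subgrp_def smul_def)

lemma subgrp_sum: "subgrp V \<Longrightarrow> (\<And>j. j \<in> A \<Longrightarrow> x j \<in> V) \<Longrightarrow> sum x A \<in> V"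
  by (induction A rule: infinite_finite_induct) (auto simp: subgrp_def)

definition torsion_split :: "(('i \<Rightarrow> bit) \<Rightarrow> ('i \<Rightarrow> bit)) \<Rightarrow> ('i \<Rightarrow> bit) set \<Rightarrow> bool"
  where "torsion_split f V \<longleftrightarrow> (\<exists>u e. additive u \<and> additive e \<and>
    (\<forall>x\<in>V. u x \<in> V \<and> e x \<in> V \<and> f x = u x + e x \<and> u (u (u (u x))) = x \<and> e (e x) = e x))"

text \<open>
  The projection \<open>P\<close> encodes the direct sum: its image is one summand and its kernel the other.
\<close>

lemma torsion_split_direct_sum:
  fixes f :: "('i \<Rightarrow> bit) \<Rightarrow> ('i \<Rightarrow> bit)"
  assumes V: "subgrp V" and f: "additive f" and P: "additive P"
    and PV: "\<And>x. x \<in> V \<Longrightarrow> P x \<in> V \<and> P (P x) = P x"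
    and C: "torsion_split f {x\<in>V. P x = x}" and W: "torsion_split f {x\<in>V. P x = 0}"
  shows "torsion_split f V"
proof -
  obtain u1 e1 where 1: "additive u1" "additive e1"
    "\<And>x. x \<in> V \<Longrightarrow> P x = x \<Longrightarrow> u1 x \<in> V \<and> P (u1 x) = u1 x \<and> e1 x \<in> V \<and> P (e1 x) = e1 x
       \<and> f x = u1 x + e1 x \<and> u1 (u1 (u1 (u1 x))) = x \<and> e1 (e1 x) = e1 x"
    using C unfolding torsion_split_def by auto
  obtain u2 e2 where 2: "additive u2" "additive e2"
    "\<And>x. x \<in> V \<Longrightarrow> P x = 0 \<Longrightarrow> u2 x \<in> V \<and> P (u2 x) = 0 \<and> e2 x \<in> V \<and> P (e2 x) = 0
       \<and> f x = u2 x + e2 x \<and> u2 (u2 (u2 (u2 x))) = x \<and> e2 (e2 x) = e2 x"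
    using W unfolding torsion_split_def by auto
  note add = additive.add[OF f] additive.add[OF P] additive.add[OF 1(1)] additive.add[OF 1(2)]
    additive.add[OF 2(1)] additive.add[OF 2(2)]
  define u where "u x = u1 (P x) + u2 (x + P x)" for x
  define e where "e x = e1 (P x) + e2 (x + P x)" for x
  have au: "additive u" and ae: "additive e"
    by (unfold_locales, simp add: u_def e_def add ac_simps)+
  have VD: "\<And>x y. x \<in> V \<Longrightarrow> y \<in> V \<Longrightarrow> x + y \<in> V" using V by (simp add: subgrp_def)
  have u: "u (c + w) = u1 c + u2 w" and e: "e (c + w) = e1 c + e2 w"
    if "c \<in> V" "P c = c" "w \<in> V" "P w = 0" for c w
    using that by (simp_all add: u_def e_def add(2) ac_simps)
  show ?thesis unfolding torsion_split_def
  proof (rule exI[of _ u], rule exI[of _ e], intro conjI ballI au ae)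
    fix x assume x: "x \<in> V"
    define c w where "c = P x" and "w = x + P x"
    have c: "c \<in> V" "P c = c" and w: "w \<in> V" "P w = 0" and xcw: "x = c + w"
      using x PV VD by (auto simp: c_def w_def add(2) ac_simps)
    note c1 = 1(3)[OF c] and w2 = 2(3)[OF w]
    note uc = 1(3)[of "u1 c"] 1(3)[of "u1 (u1 c)"] 1(3)[of "u1 (u1 (u1 c))"]
    note uw = 2(3)[of "u2 w"] 2(3)[of "u2 (u2 w)"] 2(3)[of "u2 (u2 (u2 w))"]
    show "u x \<in> V" "e x \<in> V"
      using c1 w2 VD by (simp_all add: xcw u[OF c w] e[OF c w])
    show "f x = u x + e x"
      using c1 w2 by (simp add: xcw u[OF c w] e[OF c w] add(1) ac_simps)
    show "u (u (u (u x))) = x" using c w c1 w2 uc uw by (simp add: xcw u)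
    show "e (e x) = e x" using c w c1 w2 by (simp add: xcw e)
  qed
qed

text \<open>
  The splitting is \<open>f = (1 + q) + (1 + e)\<close>: in characteristic 2 the two ones cancel,
  \<open>(1 + q)\<^sup>4 = 1 + q\<^sup>4\<close>, and \<open>1 + e\<close> is again idempotent.
\<close>

lemma torsion_split_of_nilpotent:
  fixes f :: "('i \<Rightarrow> bit) \<Rightarrow> ('i \<Rightarrow> bit)"
  assumes V: "subgrp V" and q: "additive q" and e: "additive e"
    and "\<And>x. x \<in> V \<Longrightarrow> q x \<in> V \<and> e x \<in> V \<and> f x = q x + e x \<and> q (q (q (q x))) = 0 \<and> e (e x) = e x"
  shows "torsion_split f V"
proof -
  have VD: "\<And>x y. x \<in> V \<Longrightarrow> y \<in> V \<Longrightarrow> x + y \<in> V" using V by (simp add: subgrp_def)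
  have "additive (\<lambda>x. x + q x)" "additive (\<lambda>x. x + e x)"
    by (unfold_locales, simp add: additive.add[OF q] additive.add[OF e] ac_simps)+
  then show ?thesis unfolding torsion_split_def
    using assms(4) VD
    by (rule_tac exI[of _ "\<lambda>x. x + q x"], rule_tac exI[of _ "\<lambda>x. x + e x"])
      (simp add: additive.add[OF q] additive.add[OF e] ac_simps)
qed

section \<open>Splitting a cyclic operator\<close>

text \<open>
  The functionals \<open>lam j\<close> with \<open>j < d\<close> are coordinates on the image of the projection \<open>P\<close>, and the
  vectors \<open>g j\<close> form the basis dual to them.  The recursion \<open>lam_Suc\<close> describes the matrix of \<open>f\<close> in
  this basis: every row but the last has the entry \<open>delta j\<close> on the diagonal and a one to its
  right.  The functional \<open>lam d\<close>, which is one step beyond the coordinates, carries the last row,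
  up to its diagonal entry \<open>delta (d - 1)\<close>.
\<close>

locale hessenberg_block =
  fixes f :: "('i \<Rightarrow> bit) \<Rightarrow> ('i \<Rightarrow> bit)" and V :: "('i \<Rightarrow> bit) set" and d :: nat
    and lam :: "nat \<Rightarrow> ('i \<Rightarrow> bit) \<Rightarrow> bit" and g :: "nat \<Rightarrow> 'i \<Rightarrow> bit" and delta :: "nat \<Rightarrow> bit"
    and P :: "('i \<Rightarrow> bit) \<Rightarrow> 'i \<Rightarrow> bit"
  assumes V: "subgrp V" and f: "additive f" and lam: "additive (lam j)"
    and gV: "j < d \<Longrightarrow> g j \<in> V"
    and dual: "i < d \<Longrightarrow> j < d \<Longrightarrow> lam i (g j) = of_bool (i = j)"
    and lam_Suc: "lam (Suc j) x = lam j (f x) + delta j * lam j x"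
    and P_def: "P x = (\<Sum>j<d. smul (lam j x) (g j))"
    and f_inv: "x \<in> V \<Longrightarrow> P x = x \<Longrightarrow> f x \<in> V \<and> P (f x) = f x"
begin

definition comb :: "(nat \<Rightarrow> bit) \<Rightarrow> 'i \<Rightarrow> bit"
  where "comb y = (\<Sum>j<d. smul (y j) (g j))"

lemma lam_comb: "i < d \<Longrightarrow> lam i (comb y) = y i"
  by (simp add: comb_def additive.sum[OF lam] additive_smul[OF lam] dual of_bool_def if_distrib cong: if_cong)

lemma comb_V: "comb y \<in> V"
  unfolding comb_def by (intro subgrp_sum V subgrp_smul) (simp add: gV)

lemma P_comb: "P x = comb (\<lambda>j. lam j x)"
  by (simp add: P_def comb_def)

lemma P_comb_comb: "P (comb y) = comb y"
  unfolding P_comb by (subst (1 2) comb_def) (intro sum.cong, simp_all add: lam_comb)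

lemma eq_by_coordinates:
  assumes "P x = x" "P y = y" "\<And>i. i < d \<Longrightarrow> lam i x = lam i y"
  shows "x = y"
proof -
  have "P x = P y" unfolding P_def using assms(3) by (intro sum.cong) simp_all
  then show ?thesis using assms by simp
qed

lemma lam_expand:
  assumes "P x = x" shows "lam k x = (\<Sum>j<d. lam j x * lam k (g j))"
  by (subst assms[symmetric]) (simp add: P_def additive.sum[OF lam] additive_smul[OF lam])

lemma additive_comb:
  assumes "\<And>j. additive (F j)" shows "additive (\<lambda>x. comb (\<lambda>j. F j x))"
  by unfold_locales (simp add: comb_def additive.add[OF assms] smul_add sum.distrib)

lemma P_add: "P (x + y) = P x + P y"
  by (simp add: P_def additive.add[OF lam] smul_add sum.distrib)

lemma subgrp_block: "subgrp {x \<in> V. P x = x}"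
  using V by (auto simp: subgrp_def P_add) (simp add: P_def additive.zero[OF lam])

text \<open>
  The ones above the diagonal are distributed between the idempotent \<open>e\<close> and the nilpotent \<open>q\<close>: those in
  the rows of \<open>S\<close> go to \<open>e\<close>, together with the whole diagonal, and the others go to \<open>q\<close>, together
  with the last row \<open>lam d\<close>.  A row \<open>j\<close> in \<open>S\<close> then gives \<open>e\<close> a block on the coordinates \<open>j\<close> and
  \<open>j + 1\<close> with diagonal \<open>(0, 1)\<close> or \<open>(1, 0)\<close>, which is idempotent.

  Because \<open>top\<close> assigns the last one above the diagonal to \<open>e\<close>, and \<open>corner\<close> says that the last row
  has nothing in the corner, \<open>q\<close> annihilates the last basis vector.  On the quotient by that vector \<open>q\<close>
  is a partial shift, whose cube vanishes because \<open>S\<close> interrupts every run of three; the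
  fourth power of \<open>q\<close> therefore vanishes.
\<close>

lemma block_torsion_split:
  assumes S: "\<And>j. j \<in> S \<Longrightarrow> Suc j < d \<and> Suc j \<notin> S \<and> delta j + delta (Suc j) = 1"
    and S3: "\<And>j. j + 3 < d \<Longrightarrow> j \<in> S \<or> j + 1 \<in> S \<or> j + 2 \<in> S"
    and top: "\<And>j. j + 2 = d \<Longrightarrow> j \<in> S"
    and corner: "\<And>j. Suc j = d \<Longrightarrow> lam d (g j) = 0"
  shows "torsion_split f {x \<in> V. P x = x}"
proof -
  define q where "q x = comb (\<lambda>j. if j \<in> S then 0 else lam (Suc j) x)" for x
  define e where "e x = comb (\<lambda>j. delta j * lam j x + (if j \<in> S then lam (Suc j) x else 0))" for x
  have q: "additive q" unfolding q_def
    by (rule additive_comb, unfold_locales) (simp add: additive.add[OF lam])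
  have e: "additive e" unfolding e_def
    by (rule additive_comb, unfold_locales) (simp add: additive.add[OF lam] distrib_left ac_simps)
  have lq: "lam j (q x) = (if j \<in> S then 0 else lam (Suc j) x)" if "j < d" for j x
    using that by (simp add: q_def lam_comb)
  have le: "lam j (e x) = delta j * lam j x + (if j \<in> S then lam (Suc j) x else 0)" if "j < d" for j x
    using that by (simp add: e_def lam_comb)
  have Pq: "P (q x) = q x" and Pe: "P (e x) = e x" for x
    by (simp_all add: q_def e_def P_comb_comb)
  \<comment> \<open>The cube of \<open>q\<close> vanishes modulo the last basis vector.\<close>
  have low: "lam j (q (q (q x))) = 0" if j: "Suc j < d" for j x
  proof (cases "j \<in> S \<or> Suc j \<in> S \<or> Suc (Suc j) \<in> S")
    case True
    have "Suc (Suc j) < d" if "j \<notin> S" using that top[of j] j by (cases "j + 2 = d") auto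
    moreover have "Suc (Suc (Suc j)) < d" if "Suc (Suc j) \<in> S" using S that by blast
    ultimately show ?thesis using True j by (auto simp: lq)
  next
    case False
    then have "j + 2 \<noteq> d" "Suc j + 2 \<noteq> d" "\<not> j + 3 < d"
      using top S3[of j] by (auto simp: numeral_eq_Suc)
    with j have False by linarith
    then show ?thesis ..
  qed
  have q4: "q (q (q (q x))) = 0" for x
  proof (rule eq_by_coordinates)
    show "P (q (q (q (q x)))) = q (q (q (q x)))" by (rule Pq)
    show "P 0 = 0" by (simp add: P_def additive.zero[OF lam])
    fix i assume i: "i < d"
    have "lam d (q (q (q x))) = 0"
      by (subst lam_expand[OF Pq], rule sum.neutral) (metis low corner lessThan_iff less_Suc_eq
          mult_zero_left mult_zero_right Suc_lessI)
    moreover have "lam (Suc i) (q (q (q x))) = 0" if "Suc i < d" "i \<notin> S"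
      using low[of "Suc i"] that top[of i] by (cases "i + 2 = d") auto
    ultimately show "lam i (q (q (q (q x)))) = lam i 0"
      using i by (cases "Suc i = d") (auto simp: lq additive.zero[OF lam])
  qed
  have ee: "e (e x) = e x" for x
  proof (rule eq_by_coordinates[OF Pe Pe])
    fix i assume i: "i < d"
    have "delta i * (delta i * a) = delta i * a" for a by (cases "delta i") auto
    moreover have "delta i * b + delta (Suc i) * b = b" if "i \<in> S" for b
      using S[OF that] by (simp add: distrib_right[symmetric])
    ultimately show "lam i (e (e x)) = lam i (e x)"
      using i S[of i] by (auto simp: le distrib_left add.assoc)
  qed
  have fe: "f x = q x + e x" if "x \<in> V" "P x = x" for x
  proof (rule eq_by_coordinates)
    show "P (f x) = f x" using f_inv[OF that] by simp
    show "P (q x + e x) = q x + e x" by (simp add: P_add Pq Pe)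
    show "lam i (f x) = lam i (q x + e x)" if "i < d" for i
      using that by (simp add: additive.add[OF lam] lq le lam_Suc ac_simps)
  qed
  show ?thesis
    by (rule torsion_split_of_nilpotent[OF subgrp_block q e])
      (use q4 ee fe comb_V Pq Pe in \<open>auto simp: q_def e_def\<close>)
qed

text \<open>
  A traceless operator on a plane satisfies \<open>f\<^sup>2 = det f\<close>, so \<open>f\<close> is an involution or has square
  zero.  Here the determinant is \<open>lam 2 (g 0)\<close>.
\<close>

lemma traceless_plane_torsion_split:
  assumes d: "d = 2" and delta: "\<And>j. delta j = 0" and corner: "lam 2 (g 1) = 0"
  shows "torsion_split f {x \<in> V. P x = x}"
proof -
  have sq: "f (f x) = smul (lam 2 (g 0)) x" if x: "x \<in> V" "P x = x" for x
  proof (rule eq_by_coordinates)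
    have 2: "lam 2 y = lam 0 y * lam 2 (g 0)" if "P y = y" for y
      using lam_expand[OF that, of 2] corner by (simp add: d numeral_eq_Suc)
    have fx: "f x \<in> V" "P (f x) = f x" using f_inv[OF x] by simp_all
    show "P (f (f x)) = f (f x)" using f_inv[OF fx] by simp
    show "P (smul (lam 2 (g 0)) x) = smul (lam 2 (g 0)) x"
      using x by (cases "lam 2 (g 0)") (simp_all add: P_def additive.zero[OF lam])
    have l: "lam (Suc j) y = lam j (f y)" for j y by (simp add: lam_Suc delta)
    show "lam i (f (f x)) = lam i (smul (lam 2 (g 0)) x)" if "i < d" for i
      using that 2[OF x(2)] 2[OF fx(2)] l[of 0] l[of 1]
      by (auto simp: d less_Suc_eq numeral_eq_Suc additive_smul[OF lam] mult.commute)
  qed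
  show ?thesis
  proof (cases "lam 2 (g 0) = 0")
    case True
    then have 0: "f (f x) = 0" if "x \<in> V" "P x = x" for x using sq[OF that] by simp
    have "additive (\<lambda>x. 0 :: 'i \<Rightarrow> bit)" by unfold_locales simp
    then show ?thesis
      using 0 f_inv additive.zero[OF f] V
      by (intro torsion_split_of_nilpotent[OF subgrp_block f, of "\<lambda>_. 0"])
        (auto simp: subgrp_def P_def additive.zero[OF lam])
  next
    case False
    then have 1: "f (f x) = x" if "x \<in> V" "P x = x" for x using sq[OF that] by simp
    have "additive (\<lambda>x. 0 :: 'i \<Rightarrow> bit)" by unfold_locales simp
    then show ?thesis unfolding torsion_split_def
      using 1 f_inv f V
      by (intro exI[of _ f] exI[of _ "\<lambda>_. 0"] conjI)
        (auto simp: subgrp_def P_def additive.zero[OF lam])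
  qed
qed

text \<open>
  The pairs occupy the coordinates from the top downwards, each with diagonal \<open>(0, 1)\<close>.
  The number \<open>s\<close> counts the single coordinates left over at the bottom: one if \<open>d\<close> is odd; if \<open>d\<close> is even,
  none when the pairs already give the right trace (\<open>p = 0\<close>), and two otherwise.  The
  entry \<open>p\<close> of the bottom coordinate adjusts the trace.  With two single coordinates there must be a
  further pair on top of them, which excludes \<open>d = 2\<close> with \<open>p = 1\<close>.
\<close>

lemma block_torsion_split_of_trace:
  assumes d: "d > 0"
    and delta: "delta = (\<lambda>j. if j = 0 then p else of_bool (odd (d + j)))"
    and corner: "lam d (g (d - 1)) = 0"
    and nz: "\<not> (d = 2 \<and> p = 1)"
  shows "torsion_split f {x \<in> V. P x = x}"
proof -
  define s where "s = (if odd d then 1 else if p = 0 then 0 else (2::nat))"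
  define S where "S = {j. s \<le> j \<and> j + 2 \<le> d \<and> even (d + j)}"
  show ?thesis
  proof (rule block_torsion_split[of S])
    fix j
    show "Suc j < d \<and> Suc j \<notin> S \<and> delta j + delta (Suc j) = 1" if "j \<in> S"
      using that by (auto simp: S_def delta s_def split: if_splits)
    have "s \<le> 2" by (simp add: s_def)
    then show "j \<in> S \<or> j + 1 \<in> S \<or> j + 2 \<in> S" if "j + 3 < d"
      using that by (cases "j = 0 \<and> s = 2") (auto simp: S_def s_def split: if_splits)
    have "s \<le> d - 2" if "d \<ge> 2"
      using that nz d by (cases "d = 3"; cases "d = 2") (auto simp: s_def)
    then show "j \<in> S" if "j + 2 = d" using that by (auto simp: S_def)
    show "lam d (g j) = 0" if "Suc j = d" using that corner by auto
  qed
qed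

end

section \<open>Cyclic direct summands\<close>

text \<open>
  This is the inversion of a triangular matrix, one vector at a time: the new vector \<open>w d\<close> is
  invisible to the earlier functionals, so it may be used to correct the value of \<open>lam d\<close> on the earlier
  dual vectors.
\<close>

lemma unitriangular_dual_basis:
  fixes lam :: "nat \<Rightarrow> ('i \<Rightarrow> bit) \<Rightarrow> bit"
  assumes V: "subgrp V" and lam: "\<And>j. additive (lam j)"
    and w: "\<And>k. k < d \<Longrightarrow> w k \<in> V" "\<And>k. k < d \<Longrightarrow> lam k (w k) = 1"
      "\<And>j k. j < k \<Longrightarrow> k < d \<Longrightarrow> lam j (w k) = 0"
  shows "\<exists>g. (\<forall>j<d. g j \<in> V) \<and> (\<forall>i<d. \<forall>j<d. lam i (g j) = of_bool (i = j)) \<and>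
    (\<forall>k<d. (\<Sum>j<d. smul (lam j (w k)) (g j)) = w k)"
  using w
proof (induction d)
  case (Suc d)
  have "\<exists>g. (\<forall>j<d. g j \<in> V) \<and> (\<forall>i<d. \<forall>j<d. lam i (g j) = of_bool (i = j)) \<and>
    (\<forall>k<d. (\<Sum>j<d. smul (lam j (w k)) (g j)) = w k)"
    by (rule Suc.IH) (simp_all add: Suc.prems)
  then obtain g where g: "\<And>j. j < d \<Longrightarrow> g j \<in> V"
    "\<And>i j. i < d \<Longrightarrow> j < d \<Longrightarrow> lam i (g j) = of_bool (i = j)"
    "\<And>k. k < d \<Longrightarrow> (\<Sum>j<d. smul (lam j (w k)) (g j)) = w k"
    by blast
  define h where "h j = (if j = d then w d else g j + smul (lam d (g j)) (w d))" for j
  have hV: "h j \<in> V" if "j < Suc d" for j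
    using that g(1) Suc.prems(1) V subgrp_smul[OF V] by (auto simp: h_def subgrp_def less_Suc_eq)
  have hd: "lam i (h j) = of_bool (i = j)" if "i < Suc d" "j < Suc d" for i j
    using that g(2) Suc.prems(2,3)
    by (auto simp: h_def less_Suc_eq additive.add[OF lam] additive_smul[OF lam])
  have eq: "(\<Sum>j<d. smul (lam j x) (h j)) =
      (\<Sum>j<d. smul (lam j x) (g j)) + smul (lam d (\<Sum>j<d. smul (lam j x) (g j))) (w d)" for x
  proof -
    have sm: "smul a (smul b y) = smul (a * b) y" for a b and y :: "'i \<Rightarrow> bit" by (cases a) auto
    have ss: "(\<Sum>j<n. smul (F j) y) = smul (\<Sum>j<n. F j) y" for F and n :: nat and y :: "'i \<Rightarrow> bit"
      by (induction n) (simp_all add: smul_add)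
    have "(\<Sum>j<d. smul (lam j x) (h j)) =
      (\<Sum>j<d. smul (lam j x) (g j) + smul (lam j x * lam d (g j)) (w d))"
      by (intro sum.cong) (auto simp: h_def smul_add_right sm)
    then show ?thesis
      by (simp add: sum.distrib ss additive.sum[OF lam] additive_smul[OF lam])
  qed
  have hw: "(\<Sum>j<Suc d. smul (lam j (w k)) (h j)) = w k" if k: "k < Suc d" for k
  proof (cases "k = d")
    case True
    have "(\<Sum>j<d. smul (lam j (w d)) (g j)) = 0"
      by (intro sum.neutral) (simp add: Suc.prems(3))
    then show ?thesis using True
      by (simp add: eq additive.zero[OF lam] Suc.prems(2)) (simp add: h_def)
  next
    case False
    with k have "k < d" by simp
    then show ?thesis by (simp add: eq g(3)) (simp add: h_def add.assoc)
  qed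
  show ?case using hV hd hw by blast
qed simp

text \<open>
  A chain makes the Hankel matrix of the values \<open>phi (f\<^sup>i\<^sup>+\<^sup>j v)\<close>, for \<open>i\<close> and \<open>j\<close> at most \<open>m\<close>,
  anti-triangular with ones on the antidiagonal.
\<close>

definition chain :: "(('i \<Rightarrow> bit) \<Rightarrow> ('i \<Rightarrow> bit)) \<Rightarrow> (('i \<Rightarrow> bit) \<Rightarrow> bit) \<Rightarrow> ('i \<Rightarrow> bit) \<Rightarrow> nat \<Rightarrow> bool"
  where "chain f phi v m \<longleftrightarrow> additive phi \<and> (\<forall>i<m. phi ((f ^^ i) v) = 0) \<and> phi ((f ^^ m) v) = 1"

text \<open>
  The functional \<open>phi\<close> composed with the product of \<open>f + delta i\<close> for \<open>i < j\<close>, as in the Newton basis of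
  polynomial interpolation.
\<close>

primrec newton :: "(nat \<Rightarrow> bit) \<Rightarrow> (('i \<Rightarrow> bit) \<Rightarrow> ('i \<Rightarrow> bit)) \<Rightarrow> (('i \<Rightarrow> bit) \<Rightarrow> bit) \<Rightarrow> nat \<Rightarrow> ('i \<Rightarrow> bit) \<Rightarrow> bit"
  where "newton delta f phi 0 x = phi x"
  | "newton delta f phi (Suc j) x = newton delta f phi j (f x) + delta j * newton delta f phi j x"

lemma additive_coordinate: "additive (\<lambda>x :: 'i \<Rightarrow> bit. x i)"
  by unfold_locales simp

lemma additive_funpow: "additive f \<Longrightarrow> additive (f ^^ i)"
  for f :: "('i \<Rightarrow> bit) \<Rightarrow> ('i \<Rightarrow> bit)"
  by (induction i) (simp_all add: additive_def)

lemma additive_newton: "additive f \<Longrightarrow> additive phi \<Longrightarrow> additive (newton delta f phi j)"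
  by (induction j) (simp_all add: additive_def distrib_left ac_simps)

lemma funpow_mem: "(\<And>x. x \<in> V \<Longrightarrow> f x \<in> V) \<Longrightarrow> v \<in> V \<Longrightarrow> (f ^^ i) v \<in> V"
  by (induction i) auto

text \<open>
  The iterates of \<open>v\<close> up to exponent \<open>m\<close> are distinct, because a coincidence of two of them would, after
  applying a further power of \<open>f\<close>, identify \<open>f\<^sup>m v\<close> with an earlier iterate, although \<open>phi\<close> separates the two.
\<close>

lemma chain_less_card:
  fixes f :: "('i \<Rightarrow> bit) \<Rightarrow> ('i \<Rightarrow> bit)"
  assumes "finite V" "\<And>x. x \<in> V \<Longrightarrow> f x \<in> V" "v \<in> V" "chain f phi v m"
  shows "m < card V"
proof -
  have ne: "(f ^^ i) v \<noteq> (f ^^ j) v" if "i < j" "j \<le> m" for i j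
  proof
    assume "(f ^^ i) v = (f ^^ j) v"
    then have "(f ^^ (m - j)) ((f ^^ i) v) = (f ^^ (m - j)) ((f ^^ j) v)" by simp
    then have "(f ^^ (m - j + i)) v = (f ^^ m) v"
      using that funpow_add[of "m - j" i f] funpow_add[of "m - j" j f] by simp
    moreover have "m - j + i < m" using that by simp
    ultimately show False using assms(4) unfolding chain_def by (metis zero_neq_one)
  qed
  have "inj_on (\<lambda>i. (f ^^ i) v) {..m}"
  proof (rule inj_onI)
    fix i j assume "i \<in> {..m}" "j \<in> {..m}" "(f ^^ i) v = (f ^^ j) v"
    then show "i = j" using ne[of i j] ne[of j i] by (cases i j rule: linorder_cases) auto
  qed
  moreover have "(\<lambda>i. (f ^^ i) v) ` {..m} \<subseteq> V"
    using funpow_mem[of V f v, OF assms(2,3)] by blast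
  ultimately have "card {..m} \<le> card V" by (metis card_inj_on_le assms(1))
  then show ?thesis by simp
qed

text \<open>
  Passing from \<open>phi\<close> and its iterates to the Newton functionals is a unitriangular change of basis.
  The last claim computes the first subleading coefficient: it is the sum of the shifts, which is how the
  diagonal enters the trace.
\<close>

lemma newton_shift:
  assumes "\<forall>i<n. phi ((f ^^ i) v) = 0"
  shows newton_shift_0: "j + k < n \<Longrightarrow> newton delta f phi j ((f ^^ k) v) = 0"
    and newton_shift_top: "j + k = n \<Longrightarrow> newton delta f phi j ((f ^^ k) v) = phi ((f ^^ n) v)"
    and newton_shift_next: "phi ((f ^^ n) v) = 1 \<Longrightarrow> j + k = Suc n \<Longrightarrow>
      newton delta f phi j ((f ^^ k) v) = phi ((f ^^ Suc n) v) + (\<Sum>i<j. delta i)"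
proof -
  have 0: "newton delta f phi j ((f ^^ k) v) = 0" if "j + k < n" for j k
    using that
  proof (induction j arbitrary: k)
    case (Suc j)
    then show ?case using Suc.IH[of "Suc k"] Suc.IH[of k] by simp
  qed (simp add: assms)
  have 1: "newton delta f phi j ((f ^^ k) v) = phi ((f ^^ n) v)" if "j + k = n" for j k
    using that
  proof (induction j arbitrary: k)
    case (Suc j)
    then show ?case using Suc.IH[of "Suc k"] 0[of j k] by simp
  qed simp
  have 2: "newton delta f phi j ((f ^^ k) v) = phi ((f ^^ Suc n) v) + (\<Sum>i<j. delta i)"
    if "phi ((f ^^ n) v) = 1" "j + k = Suc n" for j k
    using that
  proof (induction j arbitrary: k)
    case (Suc j)
    then show ?case using Suc.IH[of "Suc k"] 1[of j k] by (simp add: ac_simps)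
  qed simp
  show "j + k < n \<Longrightarrow> newton delta f phi j ((f ^^ k) v) = 0"
    "j + k = n \<Longrightarrow> newton delta f phi j ((f ^^ k) v) = phi ((f ^^ n) v)"
    "phi ((f ^^ n) v) = 1 \<Longrightarrow> j + k = Suc n \<Longrightarrow>
      newton delta f phi j ((f ^^ k) v) = phi ((f ^^ Suc n) v) + (\<Sum>i<j. delta i)"
    by (fact 0 1 2)+
qed

text \<open>
  The same change of basis read in the other direction: where the first \<open>n\<close> Newton functionals vanish,
  so do the first \<open>n\<close> iterates of \<open>phi\<close>, and the next ones agree.
\<close>

lemma vanish_newton:
  assumes "\<And>j. j < n \<Longrightarrow> newton delta f phi j w = 0"
  shows "j + k < n \<Longrightarrow> newton delta f phi j ((f ^^ k) w) = 0"
    and "j + k = n \<Longrightarrow> newton delta f phi j ((f ^^ k) w) = newton delta f phi n w"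
proof -
  have 0: "newton delta f phi j ((f ^^ k) w) = 0" if "j + k < n" for j k
    using that
  proof (induction k arbitrary: j)
    case (Suc k)
    then show ?case using Suc.IH[of "Suc j"] Suc.IH[of j] by simp
  qed (simp add: assms)
  show "j + k < n \<Longrightarrow> newton delta f phi j ((f ^^ k) w) = 0" by (rule 0)
  show "j + k = n \<Longrightarrow> newton delta f phi j ((f ^^ k) w) = newton delta f phi n w"
  proof (induction k arbitrary: j)
    case (Suc k)
    then show ?case using Suc.IH[of "Suc j"] 0[of j k] by simp
  qed simp
qed

text \<open>
  A chain of maximal length splits off a cyclic summand, and the complement is smaller.  Maximality is
  used twice.  If the complement \<open>W\<close> were not invariant, some \<open>x\<close> in \<open>W\<close> would have \<open>lam d x = 1\<close> and would
  start, with the same functional, a chain longer by one.  If \<open>P\<close> did not fix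
  all iterates of \<open>v\<close>, let \<open>f\<^sup>i v\<close> be the first one that it moves; then \<open>i \<ge> d\<close>, and some
  coordinate of \<open>x + P x\<close>, as a functional of \<open>x\<close>, turns the iterates of \<open>v\<close> into a chain of length
  \<open>i\<close>.
\<close>

lemma torsion_split_exists:
  fixes f :: "('i \<Rightarrow> bit) \<Rightarrow> ('i \<Rightarrow> bit)"
  assumes "finite V" "subgrp V" "additive f" "\<And>x. x \<in> V \<Longrightarrow> f x \<in> V"
  shows "torsion_split f V"
  using assms
proof (induction "card V" arbitrary: V rule: less_induct)
  case less
  note fin = less.prems(1) and V = less.prems(2) and f = less.prems(3) and fV = less.prems(4)
  have add_V: "x + y \<in> V" if "x \<in> V" "y \<in> V" for x y using V that by (simp add: subgrp_def)
  show ?case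
  proof (cases "V = {0}")
    case True
    then show ?thesis unfolding torsion_split_def using additive.zero[OF f]
      by (auto intro!: exI[of _ "\<lambda>x. x"] simp: additive_def)
  next
    case False
    obtain v0 where v0: "v0 \<in> V" "v0 \<noteq> 0" using False V by (auto simp: subgrp_def)
    then obtain i0 where "v0 i0 = 1" by (auto simp: fun_eq_iff)
    then have "chain f (\<lambda>x. x i0) v0 0" by (simp add: chain_def additive_coordinate)
    then have ex: "\<exists>m. \<exists>v\<in>V. \<exists>phi. chain f phi v m" using v0 by blast
    define m where "m = (GREATEST m. \<exists>v\<in>V. \<exists>phi. chain f phi v m)"
    have bnd1: "k \<le> card V" if "w \<in> V" "chain f psi w k" for w psi k
      by (rule less_imp_le, rule chain_less_card[OF fin _ that]) (rule fV)
    have bnd: "k \<le> card V" if "\<exists>v\<in>V. \<exists>phi. chain f phi v k" for k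
      using that bnd1 by auto
    have "\<exists>v\<in>V. \<exists>phi. chain f phi v m"
      unfolding m_def by (rule GreatestI_ex_nat[OF ex bnd])
    then obtain v phi where v: "v \<in> V" and ch: "chain f phi v m" by blast
    have maxm: "k \<le> m" if "w \<in> V" "chain f psi w k" for w psi k
      unfolding m_def by (rule Greatest_le_nat[OF _ bnd]) (use that in blast)
    define d where "d = Suc m"
    have phi: "additive phi" "\<And>i. i < m \<Longrightarrow> phi ((f ^^ i) v) = 0" "phi ((f ^^ m) v) = 1"
      using ch by (auto simp: chain_def)
    define a where "a = phi ((f ^^ d) v)"
    \<comment> \<open>The trace of \<open>f\<close> on the cyclic summand is \<open>a\<close>, and \<open>p\<close> is what the other diagonal entries lack of it.\<close>
    define p where "p = a + (\<Sum>j<m. of_bool (odd (d + Suc j)))"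
    define delta where "delta = (if d = 2 \<and> p = 1 then (\<lambda>j. 0 :: bit)
        else (\<lambda>j. if j = 0 then p else of_bool (odd (d + j))))"
    have sumdd: "(\<Sum>i<d. delta i) = a"
    proof (cases "d = 2 \<and> p = 1")
      case True
      then have "p = a + 1" by (simp add: p_def d_def del: sum_of_bool_eq)
      then have "a = 0" using True by (cases a) auto
      then show ?thesis using True by (simp add: delta_def)
    next
      case False
      have "(\<Sum>i<d. delta i) = delta 0 + (\<Sum>i<m. delta (Suc i))"
        unfolding d_def by (rule sum.lessThan_Suc_shift)
      also have "(\<Sum>i<m. delta (Suc i)) = (\<Sum>j<m. of_bool (odd (d + Suc j)))"
        using False by (intro sum.cong) (auto simp: delta_def)
      also have "delta 0 = p" using False by (auto simp: delta_def)
      finally show ?thesis by (simp add: p_def add.assoc del: sum_of_bool_eq)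
    qed
    define lam where "lam = newton delta f phi"
    have lam: "additive (lam j)" for j unfolding lam_def by (rule additive_newton[OF f phi(1)])
    define w where "w k = (f ^^ (m - k)) v" for k
    \<comment> \<open>The span of the iterates of \<open>v\<close>, described by duality.\<close>
    define U where "U = {x \<in> V. \<forall>psi. additive psi \<longrightarrow> (\<forall>i. psi ((f ^^ i) v) = (0::bit)) \<longrightarrow> psi x = 0}"
    have U: "subgrp U"
      unfolding subgrp_def
    proof (intro conjI ballI)
      show "0 \<in> U" using V additive.zero by (auto simp: U_def subgrp_def)
      fix x y assume xy: "x \<in> U" "y \<in> U"
      have "psi (x + y) = 0" if "additive psi" "\<forall>i. psi ((f ^^ i) v) = (0::bit)" for psi
        using xy that by (auto simp: U_def additive.add[OF that(1)])
      then show "x + y \<in> U" using xy add_V by (simp add: U_def)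
    qed
    have vU: "(f ^^ i) v \<in> U" for i
      using funpow_mem[OF fV v] by (simp add: U_def)
    have fU: "f x \<in> U" if "x \<in> U" for x
    proof -
      have "psi (f x) = 0" if psi: "additive psi" "\<forall>i. psi ((f ^^ i) v) = (0::bit)" for psi
      proof -
        have "additive (\<lambda>x. psi (f x))"
          by unfold_locales (simp add: additive.add[OF f] additive.add[OF psi(1)])
        moreover have "\<forall>i. psi (f ((f ^^ i) v)) = 0"
          using psi(2)[rule_format, of "Suc _"] by simp
        ultimately show ?thesis using \<open>x \<in> U\<close> unfolding U_def by blast
      qed
      then show ?thesis using that fV by (simp add: U_def)
    qed
    have phi0: "\<forall>i<m. phi ((f ^^ i) v) = 0" using phi by blast
    obtain g where gU: "\<And>j. j < d \<Longrightarrow> g j \<in> U"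
      and dual: "\<And>i j. i < d \<Longrightarrow> j < d \<Longrightarrow> lam i (g j) = of_bool (i = j)"
      and gw: "\<And>k. k < d \<Longrightarrow> (\<Sum>j<d. smul (lam j (w k)) (g j)) = w k"
    proof -
      have "\<exists>g. (\<forall>j<d. g j \<in> U) \<and> (\<forall>i<d. \<forall>j<d. lam i (g j) = of_bool (i = j)) \<and>
        (\<forall>k<d. (\<Sum>j<d. smul (lam j (w k)) (g j)) = w k)"
      proof (rule unitriangular_dual_basis[OF U lam])
        show "w k \<in> U" for k using vU by (simp add: w_def)
        show "lam k (w k) = 1" if "k < d" for k
          using that phi(3) newton_shift_top[OF phi0, of k "m - k"] by (simp add: lam_def w_def d_def)
        show "lam j (w k) = 0" if "j < k" "k < d" for j k
          using that newton_shift_0[OF phi0, of j "m - k"] by (simp add: lam_def w_def d_def)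
      qed
      then show thesis using that by blast
    qed
    define P where "P x = (\<Sum>j<d. smul (lam j x) (g j))" for x
    have PU: "P x \<in> U" for x
      unfolding P_def by (intro subgrp_sum U subgrp_smul) (simp add: gU)
    have P: "additive P"
      by unfold_locales (simp add: P_def additive.add[OF lam] smul_add sum.distrib)
    have lamP: "lam i (P x) = lam i x" if "i < d" for i x
      using that by (simp add: P_def additive.sum[OF lam] additive_smul[OF lam] dual of_bool_def if_distrib cong: if_cong)
    have PP: "P (P x) = P x" for x
      unfolding P_def[of "P x"] by (subst P_def) (intro sum.cong, simp_all add: lamP)
    have Pv: "P ((f ^^ i) v) = (f ^^ i) v" for i
    proof (induction i rule: less_induct)
      case (less i)
      show ?case
      proof (cases "i < d")
        case True
        then show ?thesis using gw[of "m - i"] by (simp add: P_def w_def d_def)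
      next
        case False
        show ?thesis
        proof (rule ccontr)
          assume "P ((f ^^ i) v) \<noteq> (f ^^ i) v"
          then have "(f ^^ i) v + P ((f ^^ i) v) \<noteq> 0" using vec_add_eq_0_iff by metis
          then obtain t where t: "((f ^^ i) v + P ((f ^^ i) v)) t = 1"
            by (auto simp: fun_eq_iff)
          have "additive (\<lambda>x. (x + P x) t)"
            by unfold_locales (simp add: additive.add[OF P] ac_simps)
          then have "chain f (\<lambda>x. (x + P x) t) v i"
            using t less by (simp add: chain_def)
          then have "i \<le> m" by (rule maxm[OF v])
          then show False using False by (simp add: d_def)
        qed
      qed
    qed
    have P_U: "P x = x" if "x \<in> U" for x
    proof (rule ccontr)
      assume "P x \<noteq> x"
      then have "x + P x \<noteq> 0" using vec_add_eq_0_iff by metis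
      then obtain t where t: "(x + P x) t = 1" by (auto simp: fun_eq_iff)
      have "additive (\<lambda>x. (x + P x) t)"
        by unfold_locales (simp add: additive.add[OF P] ac_simps)
      moreover have "\<forall>i. ((f ^^ i) v + P ((f ^^ i) v)) t = 0" by (simp add: Pv)
      ultimately have "(x + P x) t = 0" using that unfolding U_def by blast
      with t show False by simp
    qed
    have UV: "U \<subseteq> V" by (auto simp: U_def)
    interpret hessenberg_block f V d lam g delta P
    proof (rule hessenberg_block.intro)
      show "subgrp V" "additive f" "additive (lam j)" for j by (fact V f lam)+
      show "g j \<in> V" if "j < d" for j using gU[OF that] UV by blast
      show "lam i (g j) = of_bool (i = j)" if "i < d" "j < d" for i j by (rule dual[OF that])
      show "lam (Suc j) x = lam j (f x) + delta j * lam j x" for j x by (simp add: lam_def)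
      show "P x = (\<Sum>j<d. smul (lam j x) (g j))" for x by (rule P_def)
      fix x assume "x \<in> V" "P x = x"
      then have "f x \<in> U" using PU[of x] fU by simp
      then show "f x \<in> V \<and> P (f x) = f x" using UV P_U by blast
    qed
    have gm: "g m = v"
    proof -
      have "v = P v" using Pv[of 0] by simp
      also have "\<dots> = (\<Sum>j<d. if j = m then g j else 0)"
        unfolding P_def
      proof (intro sum.cong refl)
        fix j assume "j \<in> {..<d}"
        then show "smul (lam j v) (g j) = (if j = m then g j else 0)"
          using newton_shift_0[OF phi0, of j 0 delta] newton_shift_top[OF phi0, of j 0 delta] phi(3)
          by (auto simp: lam_def d_def less_Suc_eq)
      qed
      also have "\<dots> = g m" by (simp add: d_def)
      finally show ?thesis by simp
    qed
    have corner: "lam d (g m) = 0"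
    proof -
      have "lam d v = a + (\<Sum>i<d. delta i)"
        unfolding lam_def a_def using newton_shift_next[OF phi0 phi(3), of d 0 delta]
        by (simp add: d_def del: sum.lessThan_Suc)
      then show ?thesis by (simp add: gm sumdd)
    qed
    have C: "torsion_split f {x \<in> V. P x = x}"
    proof (cases "d = 2 \<and> p = 1")
      case True
      then show ?thesis using corner
        by (intro traceless_plane_torsion_split) (auto simp: delta_def d_def numeral_eq_Suc)
    next
      case False
      then show ?thesis using corner
        by (intro block_torsion_split_of_trace) (auto simp: delta_def d_def)
    qed
    have W: "torsion_split f {x \<in> V. P x = 0}"
    proof (rule less.hyps)
      have "P v = v" using Pv[of 0] by simp
      moreover have "v \<noteq> 0"
      proof
        assume "v = 0"
        then have "phi ((f ^^ m) v) = 0"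
          by (simp add: additive.zero[OF phi(1)] additive.zero[OF additive_funpow[OF f]])
        then show False using phi(3) by simp
      qed
      ultimately have "v \<notin> {x \<in> V. P x = 0}" by simp
      then have "{x \<in> V. P x = 0} \<subset> V" using v by blast
      then show "card {x \<in> V. P x = 0} < card V" by (rule psubset_card_mono[OF fin])
      show "finite {x \<in> V. P x = 0}" using fin by simp
      show "subgrp {x \<in> V. P x = 0}"
        using V by (auto simp: subgrp_def additive.zero[OF P] additive.add[OF P])
      show "additive f" by (rule f)
      fix x assume "x \<in> {x \<in> V. P x = 0}"
      then have x: "x \<in> V" "P x = 0" by simp_all
      have l: "lam j x = 0" if "j < d" for j
        using lamP[OF that, of x] x by (simp add: additive.zero[OF lam])
      then have l': "newton delta f phi j x = 0" if "j < d" for j using that by (simp add: lam_def)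
      have ld: "lam d x = 0"
      proof (rule ccontr)
        assume "lam d x \<noteq> 0"
        then have "lam d x = 1" by simp
        moreover have "phi ((f ^^ k) x) = 0" if "k < d" for k
          using vanish_newton(1)[of d delta f phi x 0 k, OF l'] that by simp
        moreover have "phi ((f ^^ d) x) = lam d x"
          using vanish_newton(2)[of d delta f phi x 0 d, OF l'] by (simp add: lam_def)
        ultimately have "chain f phi x d" using phi(1) by (simp add: chain_def)
        then have "d \<le> m" by (rule maxm[OF x(1)])
        then show False by (simp add: d_def)
      qed
      have "lam j (f x) = 0" if "j < d" for j
        using lam_Suc[of j x] l[OF that] l[of "Suc j"] ld that by (cases "Suc j = d") auto
      then have "P (f x) = 0" by (simp add: P_def)
      then show "f x \<in> {x \<in> V. P x = 0}" using fV x by simp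
    qed
    show ?thesis
    proof (rule torsion_split_direct_sum[OF V f P _ C W])
      show "P x \<in> V \<and> P (P x) = P x" for x using PU[of x] PP UV by auto
    qed
  qed
qed

section \<open>From operators to matrices\<close>

text \<open>
  The index type of the vectors cannot depend on \<open>n\<close>, so a column of length \<open>n\<close> is a sequence that
  vanishes from \<open>n\<close> on.
\<close>

definition vecs :: "nat \<Rightarrow> (nat \<Rightarrow> bit) set"
  where "vecs n = {x. \<forall>i. i \<ge> n \<longrightarrow> x i = 0}"

definition mat_act :: "nat \<Rightarrow> bit mat \<Rightarrow> (nat \<Rightarrow> bit) \<Rightarrow> nat \<Rightarrow> bit"
  where "mat_act n A x = (\<lambda>i. if i < n then \<Sum>j<n. A $$ (i, j) * x j else 0)"

definition std_vec :: "nat \<Rightarrow> nat \<Rightarrow> bit"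
  where "std_vec j = (\<lambda>i. of_bool (i = j))"

definition mat_of :: "nat \<Rightarrow> ((nat \<Rightarrow> bit) \<Rightarrow> nat \<Rightarrow> bit) \<Rightarrow> bit mat"
  where "mat_of n h = mat n n (\<lambda>(i, j). h (std_vec j) i)"

lemma mat_of_carrier [simp]: "mat_of n h \<in> carrier_mat n n"
  by (simp add: mat_of_def)

lemma std_vec_vecs: "j < n \<Longrightarrow> std_vec j \<in> vecs n"
  by (simp add: vecs_def std_vec_def)

lemma finite_vecs: "finite (vecs n)"
proof -
  have "finite (UNIV :: bit set)"
    by (rule finite_subset[of _ "{0, 1}"]) (use bit_not_zero_iff in blast)+
  then have "finite {x :: nat \<Rightarrow> bit. \<forall>i. (i \<in> {..<n} \<longrightarrow> x i \<in> UNIV) \<and> (i \<notin> {..<n} \<longrightarrow> x i = 0)}"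
    by (intro finite_set_of_finite_funs) auto
  then show ?thesis by (simp add: vecs_def not_less)
qed

lemma subgrp_vecs: "subgrp (vecs n)"
  by (simp add: subgrp_def vecs_def)

lemma additive_mat_act: "additive (mat_act n A)"
  by unfold_locales (simp add: mat_act_def fun_eq_iff distrib_left sum.distrib)

lemma mat_act_vecs: "mat_act n A x \<in> vecs n"
  by (simp add: mat_act_def vecs_def)

lemma sum_fun_apply: "(\<Sum>j\<in>A. F j) i = (\<Sum>j\<in>A. F j i)" for F :: "'a \<Rightarrow> 'b \<Rightarrow> bit"
  by (induction A rule: infinite_finite_induct) auto

lemma smul_apply: "smul c x i = c * x i"
  by (cases c) auto

lemma vecs_expand:
  assumes "x \<in> vecs n" shows "x = (\<Sum>j<n. smul (x j) (std_vec j))"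
proof
  fix i
  have "(\<Sum>j<n. smul (x j) (std_vec j)) i = (\<Sum>j<n. if j = i then x j else 0)"
    unfolding sum_fun_apply by (intro sum.cong) (auto simp: smul_apply std_vec_def)
  then show "x i = (\<Sum>j<n. smul (x j) (std_vec j)) i"
    using assms by (auto simp: vecs_def)
qed

lemma additive_expand:
  assumes h: "additive h" and x: "x \<in> vecs n"
  shows "h x i = (\<Sum>j<n. x j * h (std_vec j) i)"
proof -
  have sm: "h (smul c y) = smul c (h y)" for c y
    by (cases c) (simp_all add: additive.zero[OF h])
  have "h x i = h (\<Sum>j<n. smul (x j) (std_vec j)) i"
    using vecs_expand[OF x] by simp
  then show ?thesis by (simp add: additive.sum[OF h] sm sum_fun_apply smul_apply)
qed

lemma mat_of_comp:
  assumes "additive h" "\<And>x. x \<in> vecs n \<Longrightarrow> k x \<in> vecs n"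
  shows "mat_of n (\<lambda>x. h (k x)) = mat_of n h * mat_of n k"
proof (rule eq_matI)
  fix i j assume "i < dim_row (mat_of n h * mat_of n k)" "j < dim_col (mat_of n h * mat_of n k)"
  then have ij: "i < n" "j < n" by (simp_all add: mat_of_def)
  have "h (k (std_vec j)) i = (\<Sum>l<n. k (std_vec j) l * h (std_vec l) i)"
    by (rule additive_expand) (use assms ij std_vec_vecs in auto)
  then show "mat_of n (\<lambda>x. h (k x)) $$ (i, j) = (mat_of n h * mat_of n k) $$ (i, j)"
    using ij by (simp add: mat_of_def scalar_prod_def lessThan_atLeast0 mult.commute)
qed (simp_all add: mat_of_def)

lemma mat_of_cong: "(\<And>x. x \<in> vecs n \<Longrightarrow> h x = k x) \<Longrightarrow> mat_of n h = mat_of n k"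
  by (rule eq_matI) (simp_all add: mat_of_def std_vec_vecs)

lemma mat_of_add: "mat_of n (\<lambda>x. h x + k x) = mat_of n h + mat_of n k"
  by (rule eq_matI) (simp_all add: mat_of_def)

lemma mat_of_id: "mat_of n (\<lambda>x. x) = 1\<^sub>m n"
  by (rule eq_matI) (simp_all add: mat_of_def std_vec_def)

lemma mat_of_mat_act:
  assumes "A \<in> carrier_mat n n" shows "mat_of n (mat_act n A) = A"
proof (rule eq_matI)
  fix i j assume "i < dim_row A" "j < dim_col A"
  then have ij: "i < n" "j < n" using assms by auto
  then have "(\<Sum>l<n. A $$ (i, l) * std_vec j l) = (\<Sum>l<n. if l = j then A $$ (i, l) else 0)"
    by (intro sum.cong) (auto simp: std_vec_def)
  then show "mat_of n (mat_act n A) $$ (i, j) = A $$ (i, j)"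
    using ij by (simp add: mat_of_def mat_act_def)
qed (use assms in \<open>simp_all add: mat_of_def\<close>)

lemma mat_ring_pow:
  assumes "u \<in> carrier_mat n n"
  shows "u [^]\<^bsub>mat_ring_F2 n\<^esub> (1::nat) = u"
    "u [^]\<^bsub>mat_ring_F2 n\<^esub> (2::nat) = u * u"
    "u [^]\<^bsub>mat_ring_F2 n\<^esub> (3::nat) = u * (u * u)"
    "u [^]\<^bsub>mat_ring_F2 n\<^esub> (4::nat) = u * (u * (u * u))"
proof -
  interpret ring "mat_ring_F2 n" by (rule ring_mat)
  show "u [^]\<^bsub>mat_ring_F2 n\<^esub> (1::nat) = u"
    "u [^]\<^bsub>mat_ring_F2 n\<^esub> (2::nat) = u * u"
    "u [^]\<^bsub>mat_ring_F2 n\<^esub> (3::nat) = u * (u * u)"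
    "u [^]\<^bsub>mat_ring_F2 n\<^esub> (4::nat) = u * (u * (u * u))"
    using assms by (simp_all add: numeral_eq_Suc ring_mat_simps assoc_mult_mat[of _ n n _ n _ n])
qed

lemma almost_4_torsion_clean_mat:
  assumes "n \<ge> 1" shows "almost_torsion_clean 4 (mat_ring_F2 n)"
  unfolding almost_torsion_clean_def
proof (intro conjI ballI)
  let ?R = "mat_ring_F2 n"
  show "ring ?R" by (rule ring_mat)
  have "(1\<^sub>m n :: bit mat) $$ (0, 0) \<noteq> 0\<^sub>m n n $$ (0, 0)" using assms by simp
  then show "\<one>\<^bsub>?R\<^esub> \<noteq> \<zero>\<^bsub>?R\<^esub>" by (auto simp: ring_mat_simps)
  fix r assume "r \<in> carrier ?R"
  then have r: "r \<in> carrier_mat n n" by (simp add: ring_mat_simps)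
  have "torsion_split (mat_act n r) (vecs n)"
    by (rule torsion_split_exists) (simp_all add: finite_vecs subgrp_vecs additive_mat_act mat_act_vecs)
  then obtain u e where u: "additive u" and e: "additive e" and
    ue: "\<And>x. x \<in> vecs n \<Longrightarrow> u x \<in> vecs n \<and> e x \<in> vecs n \<and> mat_act n r x = u x + e x \<and>
      u (u (u (u x))) = x \<and> e (e x) = e x"
    unfolding torsion_split_def by blast
  let ?u = "mat_of n u" and ?e = "mat_of n e"
  have "mat_of n (\<lambda>x. u (u (u (u x)))) = ?u * mat_of n (\<lambda>x. u (u (u x)))"
    by (rule mat_of_comp[OF u]) (use ue in blast)
  also have "mat_of n (\<lambda>x. u (u (u x))) = ?u * mat_of n (\<lambda>x. u (u x))"
    by (rule mat_of_comp[OF u]) (use ue in blast)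
  also have "mat_of n (\<lambda>x. u (u x)) = ?u * ?u"
    by (rule mat_of_comp[OF u]) (use ue in blast)
  also have "mat_of n (\<lambda>x. u (u (u (u x)))) = 1\<^sub>m n"
    unfolding mat_of_id[symmetric] by (rule mat_of_cong) (use ue in blast)
  finally have u4: "?u * (?u * (?u * ?u)) = 1\<^sub>m n" by simp
  have "mat_of n (\<lambda>x. e (e x)) = ?e * ?e"
    by (rule mat_of_comp[OF e]) (use ue in blast)
  moreover have "mat_of n (\<lambda>x. e (e x)) = ?e"
    by (rule mat_of_cong) (use ue in blast)
  ultimately have ee: "?e * ?e = ?e" by simp
  have "mat_of n (mat_act n r) = mat_of n (\<lambda>x. u x + e x)"
    by (rule mat_of_cong) (use ue in blast)
  then have rue: "r = ?u + ?e" by (simp add: mat_of_add mat_of_mat_act[OF r])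
  have assoc: "?u * (?u * ?u) * ?u = ?u * (?u * (?u * ?u))"
    by (simp add: assoc_mult_mat[of _ n n _ n _ n] mult_carrier_mat[of _ n n _ n])
  have "?u * (?u * ?u) \<in> carrier ?R" "?u \<in> carrier ?R"
    by (simp_all add: ring_mat_simps mult_carrier_mat[of _ n n _ n])
  then have unit: "?u \<in> Units ?R"
    unfolding Units_def mem_Collect_eq ring_mat_simps using u4 assoc by metis
  show "\<exists>u\<in>Units ?R. \<exists>e\<in>carrier ?R. u [^]\<^bsub>?R\<^esub> (4::nat) = \<one>\<^bsub>?R\<^esub> \<and> e \<otimes>\<^bsub>?R\<^esub> e = e \<and> r = u \<oplus>\<^bsub>?R\<^esub> e"
  proof (intro bexI conjI)
    show "?u [^]\<^bsub>?R\<^esub> (4::nat) = \<one>\<^bsub>?R\<^esub>"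
      using u4 by (simp add: mat_ring_pow ring_mat_simps)
    show "?e \<otimes>\<^bsub>?R\<^esub> ?e = ?e" "r = ?u \<oplus>\<^bsub>?R\<^esub> ?e" "?e \<in> carrier ?R"
      using ee rue by (simp_all add: ring_mat_simps)
  qed (rule unit)
qed simp

section \<open>Trace obstructions\<close>

definition tr :: "'a :: comm_ring_1 mat \<Rightarrow> 'a"
  where "tr A = (\<Sum>i<dim_row A. A $$ (i, i))"

lemma tr_add: "A \<in> carrier_mat n n \<Longrightarrow> B \<in> carrier_mat n n \<Longrightarrow> tr (A + B) = tr A + tr B"
  by (simp add: tr_def sum.distrib)

lemma tr_comm:
  assumes "A \<in> carrier_mat n n" "B \<in> carrier_mat n n"
  shows "tr (A * B) = tr (B * A)"
proof -
  have "tr (A * B) = (\<Sum>i<n. \<Sum>j<n. A $$ (i, j) * B $$ (j, i))"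
    using assms by (simp add: tr_def scalar_prod_def lessThan_atLeast0)
  also have "\<dots> = (\<Sum>j<n. \<Sum>i<n. B $$ (j, i) * A $$ (i, j))"
    by (subst sum.swap) (simp add: mult.commute)
  also have "\<dots> = tr (B * A)"
    using assms by (simp add: tr_def scalar_prod_def lessThan_atLeast0)
  finally show ?thesis .
qed

lemma sum_symmetric_bit:
  fixes s :: "nat \<Rightarrow> nat \<Rightarrow> bit"
  assumes "\<And>i j. s i j = s j i"
  shows "(\<Sum>i<n. \<Sum>j<n. s i j) = (\<Sum>i<n. s i i)"
proof (induction n)
  case (Suc n)
  have "(\<Sum>i<n. s i n) = (\<Sum>j<n. s n j)" by (intro sum.cong) (simp_all add: assms[of n])
  then show ?case by (simp add: sum.distrib Suc ac_simps)
qed simp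

text \<open>
  The trace of a square in characteristic 2 is the square of the trace, because the products of
  off-diagonal entries occur twice; over the field with two elements squaring does nothing.
\<close>

lemma tr_square:
  fixes A :: "bit mat"
  assumes "A \<in> carrier_mat n n" shows "tr (A * A) = tr A"
proof -
  have "tr (A * A) = (\<Sum>i<n. \<Sum>j<n. A $$ (i, j) * A $$ (j, i))"
    using assms by (simp add: tr_def scalar_prod_def lessThan_atLeast0)
  also have "\<dots> = (\<Sum>i<n. A $$ (i, i) * A $$ (i, i))"
    by (rule sum_symmetric_bit) (rule mult.commute)
  also have "\<dots> = tr A"
    using assms by (simp add: tr_def) (intro sum.cong refl, metis bit_not_zero_iff mult_1 mult_zero_left)
  finally show ?thesis .
qed

lemma tr_one: "tr (1\<^sub>m n) = of_nat n"
  by (simp add: tr_def)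

text \<open>
  The relation \<open>(s + e)\<^sup>2 = 1\<close> is multiplied by \<open>s\<close>, \<open>s\<^sup>3\<close>, \<open>s\<^sup>2\<close> and \<open>e s\<close>, and traces are taken.
  After cyclic rotation, and because \<open>(e s)\<^sup>2\<close> has the trace of \<open>e s\<close>, the idempotent occurs only in
  the traces of \<open>e s\<close>, \<open>e s\<^sup>2\<close> and \<open>e s\<^sup>3\<close>, which can be eliminated.
\<close>

lemma tr_fifth_of_involution_plus_idempotent:
  fixes s e :: "bit mat"
  assumes s [simp]: "s \<in> carrier_mat n n" and e [simp]: "e \<in> carrier_mat n n"
    and ee: "e * e = e" and inv: "(s + e) * (s + e) = 1\<^sub>m n"
  shows "tr (s * (s * (s * (s * s)))) = tr s"
proof -
  note [simp] = mult_carrier_mat[of _ n n _ n] add_carrier_mat[of _ n n]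
    assoc_mult_mat[of _ n n _ n _ n] add_mult_distrib_mat[of _ n n _ _ n]
    mult_add_distrib_mat[of _ n n _ n] tr_add[of _ n] ee
  have ee' [simp]: "e * (e * X) = e * X" if "X \<in> carrier_mat n n" for X
    using that ee by (metis assoc_mult_mat e)
  have E: "tr (X * ((s + e) * (s + e))) = tr X" if "X \<in> carrier_mat n n" for X
    using that by (simp only: inv right_mult_one_mat)
  have c: "tr (A * B) = tr (B * A)" if "A \<in> carrier_mat n n" "B \<in> carrier_mat n n" for A B :: "bit mat"
    using that by (rule tr_comm)
  have rot: "tr (s * e) = tr (e * s)" "tr (s * (s * e)) = tr (e * (s * s))"
    "tr (s * (e * s)) = tr (e * (s * s))" "tr (s * (s * (s * e))) = tr (e * (s * (s * s)))"
    "tr (s * (s * (e * s))) = tr (e * (s * (s * s)))" "tr (e * (s * e)) = tr (e * s)"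
    "tr (s * (s * (s * (s * e)))) = tr (s * (s * (s * (e * s))))"
    "tr (e * (s * (s * e))) = tr (e * (s * s))" "tr (e * (s * (e * s))) = tr (e * s)"
    "tr (s * (s * (s * s))) = tr (s * s)"
    using c[of s e] c[of "s * s" e] c[of s "e * s"] c[of "s * (s * s)" e] c[of "s * s" "e * s"]
      c[of "e * s" e] c[of s "s * (s * (s * e))"] c[of "e * (s * s)" e]
      tr_square[of "e * s" n] tr_square[of "s * s" n]
    by simp_all
  have "tr s = tr (s * (s * s)) + tr (e * s)"
    using E[of s] by (simp add: rot)
  moreover have "tr (s * (s * s)) = tr (s * (s * (s * (s * s)))) + tr (e * (s * (s * s)))"
    using E[of "s * (s * s)"] by (simp add: rot)
  moreover have "tr (e * (s * s)) = 0"
    using E[of "s * s"] by (simp add: rot)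
  moreover have "tr (e * s) = tr (e * (s * (s * s))) + tr (e * (s * s))"
    using E[of "e * s"] by (simp add: rot ac_simps)
  ultimately show ?thesis by (simp add: ac_simps)
qed

text \<open>
  The relation \<open>(r + e)\<^sup>3 = 1\<close> is multiplied by \<open>1\<close>, \<open>r\<close> and \<open>r e\<close>, and traces are taken.  The second of
  these equations gives \<open>tr (e r\<^sup>3) = 0\<close> and the third then gives \<open>tr (e r\<^sup>4) = tr (e r\<^sup>2)\<close>; with
  \<open>r\<^sup>4 = r + 1\<close> the latter cancels all terms of the first that contain \<open>e\<close>.
\<close>

lemma tr_cube_of_order_3_unit_plus_idempotent:
  fixes r e :: "bit mat"
  assumes r [simp]: "r \<in> carrier_mat n n" and e [simp]: "e \<in> carrier_mat n n"
    and ee: "e * e = e" and inv: "(r + e) * ((r + e) * (r + e)) = 1\<^sub>m n"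
    and r4: "r * (r * (r * r)) = r + 1\<^sub>m n"
  shows "tr (r * (r * r)) = of_nat n"
proof -
  note [simp] = mult_carrier_mat[of _ n n _ n] add_carrier_mat[of _ n n]
    assoc_mult_mat[of _ n n _ n _ n] add_mult_distrib_mat[of _ n n _ _ n]
    mult_add_distrib_mat[of _ n n _ n] tr_add[of _ n] ee
  have ee' [simp]: "e * (e * X) = e * X" if "X \<in> carrier_mat n n" for X
    using that ee by (metis assoc_mult_mat e)
  have E: "tr (X * ((r + e) * ((r + e) * (r + e)))) = tr X" if "X \<in> carrier_mat n n" for X
    using that by (simp only: inv right_mult_one_mat)
  have c: "tr (A * B) = tr (B * A)" if "A \<in> carrier_mat n n" "B \<in> carrier_mat n n" for A B :: "bit mat"
    using that by (rule tr_comm)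
  have rot: "tr (r * e) = tr (e * r)" "tr (r * (r * e)) = tr (e * (r * r))"
    "tr (r * (e * r)) = tr (e * (r * r))" "tr (e * (r * e)) = tr (e * r)"
    "tr (r * (r * (r * e))) = tr (e * (r * (r * r)))" "tr (r * (r * (e * r))) = tr (e * (r * (r * r)))"
    "tr (r * (e * (r * r))) = tr (e * (r * (r * r)))"
    "tr (r * (e * (r * e))) = tr (e * r)" 
    "tr (r * (e * (r * (r * r)))) = tr (e * (r * (r * (r * r))))"
    "tr (r * (e * (r * (r * e)))) = tr (r * (e * (r * (e * r))))"
    "tr (r * (r * (r * r))) = tr r"
    using c[of r e] c[of "r * r" e] c[of r "e * r"] c[of "e * r" e] c[of "r * (r * r)" e]
      c[of "r * r" "e * r"] c[of r "e * (r * r)"] tr_square[of "r * e" n]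
      c[of r "e * (r * (r * r))"] c[of "r * (e * r)" "r * e"] 
      tr_square[of "r * r" n] tr_square[of r n]
    by simp_all
  have "tr (r * (r * r)) + tr (e * (r * r)) + tr (e * r) + tr e = of_nat n"
    using E[of "1\<^sub>m n"] by (simp add: rot tr_one ac_simps left_mult_one_mat[of _ n n])
  moreover have "tr (e * (r * (r * r))) = 0"
    using E[of r] by (simp add: rot ac_simps)
  moreover have "tr (e * (r * (r * (r * r)))) + tr (e * (r * r)) + tr (e * (r * (r * r))) = 0"
    using E[of "r * e"] by (simp add: rot ac_simps)
  moreover have "tr (e * (r * (r * (r * r)))) = tr (e * r) + tr e"
    by (simp add: r4 right_mult_one_mat[of _ n n])
  ultimately show ?thesis
    by (cases "tr e"; cases "tr (e * r)"; cases "tr (e * (r * r))"; simp)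
qed

section \<open>A matrix that generates the field with sixteen elements\<close>

text \<open>
  The companion matrix of \<open>x\<^sup>4 + x + 1\<close>, which is irreducible over the field with two elements.
\<close>

lemma companion_matrix_F16:
  fixes C defines "C \<equiv> (mat 4 4 (\<lambda>(i, j). of_bool (i = Suc j \<or> j = 3 \<and> i \<le> 1)) :: bit mat)"
  shows "C \<in> carrier_mat 4 4" "C * (C * (C * C)) = C + 1\<^sub>m 4" "tr (C * (C * C)) = 1"
proof -
  \<comment> \<open>The square of \<open>C\<close>, written out.\<close>
  define D where "D = (mat 4 4 (\<lambda>(i, j). of_bool (i = Suc (Suc j) \<or> j = 2 \<and> i \<le> 1 \<or> j = 3 \<and> (i = 1 \<or> i = 2))) :: bit mat)"
  show C: "C \<in> carrier_mat 4 4" by (simp add: C_def)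
  have CC: "C * C = D"
    by (rule eq_matI) (auto simp: C_def D_def scalar_prod_def numeral_eq_Suc less_Suc_eq)
  have "D * D = C + 1\<^sub>m 4"
    by (rule eq_matI) (auto simp: C_def D_def scalar_prod_def numeral_eq_Suc less_Suc_eq)
  then show "C * (C * (C * C)) = C + 1\<^sub>m 4"
    using C CC by (metis assoc_mult_mat mult_carrier_mat)
  show "tr (C * (C * C)) = 1"
    unfolding CC by (simp add: C_def D_def tr_def scalar_prod_def numeral_eq_Suc)
qed

lemma F16_block_matrix_exists:
  "\<exists>r :: bit mat. r \<in> carrier_mat (4 * N) (4 * N) \<and> r * (r * (r * r)) = r + 1\<^sub>m (4 * N) \<and>
     tr (r * (r * r)) = of_nat N"
proof (induction N)
  case 0
  have "0\<^sub>m 0 0 \<in> carrier_mat 0 0" by simp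
  then show ?case by (intro exI[of _ "0\<^sub>m 0 0"]) (auto simp: tr_def)
next
  case (Suc N)
  then obtain r :: "bit mat" where r: "r \<in> carrier_mat (4 * N) (4 * N)"
    "r * (r * (r * r)) = r + 1\<^sub>m (4 * N)" "tr (r * (r * r)) = of_nat N" by blast
  obtain C :: "bit mat" where C: "C \<in> carrier_mat 4 4" "C * (C * (C * C)) = C + 1\<^sub>m 4"
    "tr (C * (C * C)) = 1" using companion_matrix_F16 by blast
  define bl where "bl X Y = four_block_mat X (0\<^sub>m 4 (4 * N)) (0\<^sub>m (4 * N) 4) Y" for X Y :: "bit mat"
  have cr: "bl X Y \<in> carrier_mat (4 + 4 * N) (4 + 4 * N)"
    if "X \<in> carrier_mat 4 4" "Y \<in> carrier_mat (4 * N) (4 * N)" for X Y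
    using that unfolding bl_def by (rule four_block_carrier_mat)
  have mul: "bl X Y * bl X' Y' = bl (X * X') (Y * Y')"
    if "X \<in> carrier_mat 4 4" "Y \<in> carrier_mat (4 * N) (4 * N)"
      "X' \<in> carrier_mat 4 4" "Y' \<in> carrier_mat (4 * N) (4 * N)" for X Y X' Y'
    using that unfolding bl_def
    by (subst mult_four_block_mat[where ?nr1.0 = 4 and ?n1.0 = 4 and ?nc1.0 = 4
          and ?nr2.0 = "4 * N" and ?n2.0 = "4 * N" and ?nc2.0 = "4 * N"]) auto
  have one: "1\<^sub>m (4 + 4 * N) = bl (1\<^sub>m 4) (1\<^sub>m (4 * N))"
    unfolding bl_def by (rule eq_matI) auto
  have add: "bl X Y + bl X' Y' = bl (X + X') (Y + Y')"
    if "X \<in> carrier_mat 4 4" "Y \<in> carrier_mat (4 * N) (4 * N)"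
      "X' \<in> carrier_mat 4 4" "Y' \<in> carrier_mat (4 * N) (4 * N)" for X Y X' Y'
    using that unfolding bl_def by (intro eq_matI) auto
  have trace: "tr (bl X Y) = tr X + tr Y"
    if "X \<in> carrier_mat 4 4" "Y \<in> carrier_mat (4 * N) (4 * N)" for X Y
  proof -
    have "tr (bl X Y) = (\<Sum>i<4 + 4 * N. bl X Y $$ (i, i))" using cr[OF that] by (simp add: tr_def)
    also have "\<dots> = (\<Sum>i<4. bl X Y $$ (i, i)) + (\<Sum>i<4 * N. bl X Y $$ (4 + i, 4 + i))"
      using sum.shift_bounds_nat_ivl[of "\<lambda>i. bl X Y $$ (i, i)" 0 4 "4 * N"]
        sum.atLeastLessThan_concat[of 0 4 "4 + 4 * N" "\<lambda>i. bl X Y $$ (i, i)"]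
      by (simp add: lessThan_atLeast0 add.commute)
    also have "(\<Sum>i<4. bl X Y $$ (i, i)) = tr X"
      using that by (simp add: tr_def bl_def)
    also have "(\<Sum>i<4 * N. bl X Y $$ (4 + i, 4 + i)) = tr Y"
      using that by (simp add: tr_def bl_def)
    finally show ?thesis .
  qed
  have n: "4 * Suc N = 4 + 4 * N" by simp
  have cc: "C * C \<in> carrier_mat 4 4" "C * (C * C) \<in> carrier_mat 4 4"
    "r * r \<in> carrier_mat (4 * N) (4 * N)" "r * (r * r) \<in> carrier_mat (4 * N) (4 * N)"
    using C(1) r(1) by (simp_all add: mult_carrier_mat[of _ 4 4 _ 4] mult_carrier_mat[of _ "4 * N" "4 * N" _ "4 * N"])
  show ?case unfolding n one
    using C r cc by (intro exI[of _ "bl C r"]) (simp add: cr mul add trace)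
qed

text \<open>
  The multiplicative group of the field with 16 elements has order 15.
\<close>

lemma fifth_power_of_cube_F16:
  fixes r :: "bit mat"
  assumes r [simp]: "r \<in> carrier_mat n n" and r4: "r * (r * (r * r)) = r + 1\<^sub>m n"
  defines "s \<equiv> r * (r * r)"
  shows "s * (s * (s * (s * s))) = 1\<^sub>m n"
proof -
  note [simp] = mult_carrier_mat[of _ n n _ n] add_carrier_mat[of _ n n]
    assoc_mult_mat[of _ n n _ n _ n] add_mult_distrib_mat[of _ n n _ _ n]
    mult_add_distrib_mat[of _ n n _ n] r4 left_mult_one_mat[of _ n n] right_mult_one_mat[of _ n n]
  have r4' [simp]: "r * (r * (r * (r * X))) = r * X + X" if "X \<in> carrier_mat n n" for X
  proof -
    have "r * (r * (r * (r * X))) = (r * (r * (r * r))) * X" using that by (simp del: r4)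
    then show ?thesis using that by (simp del: assoc_mult_mat)
  qed
  have ac3: "A + (B + D) = B + (A + D)" "A + B + D = A + (B + D)"
    if "A \<in> carrier_mat n n" "B \<in> carrier_mat n n" "D \<in> carrier_mat n n" for A B D :: "bit mat"
    by (rule eq_matI; use that in \<open>auto simp: ac_simps\<close>)+
  have ac2: "A + B = B + A" "A + (A + B) = B"
    if "A \<in> carrier_mat n n" "B \<in> carrier_mat n n" for A B :: "bit mat"
    by (rule eq_matI; use that in \<open>auto simp: ac_simps\<close>)+
  note ac = ac2 ac3
  have zero: "A + A = 0\<^sub>m n n" "A + 0\<^sub>m n n = A" if "A \<in> carrier_mat n n" for A :: "bit mat"
    by (rule eq_matI; use that in auto)+
  have s2: "s * s = r * (r * r) + r * r" by (simp add: s_def)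
  have s3: "s * (r * (r * r) + r * r) = r * (r * r) + r"
    by (simp add: s_def ac zero)
  have s4: "s * (r * (r * r) + r) = r * (r * r) + (r * r + (r + 1\<^sub>m n))"
    by (simp add: s_def ac zero)
  have s5: "s * (r * (r * r) + (r * r + (r + 1\<^sub>m n))) = 1\<^sub>m n"
    by (simp add: s_def ac zero)
  show ?thesis by (simp only: s2 s3 s4 s5)
qed

section \<open>The torsion index\<close>

text \<open>
  For \<open>m = 3\<close> the matrix without a decomposition is \<open>r\<close> itself, for \<open>m = 2\<close> it is its cube, and the
  only unit allowed for \<open>m = 1\<close> is also allowed for \<open>m = 2\<close>.
\<close>

lemma not_almost_torsion_clean_below_4:
  assumes "odd N" "n = 4 * N" "0 < m" "m < 4"
  shows "\<not> almost_torsion_clean m (mat_ring_F2 n)"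
proof
  assume clean: "almost_torsion_clean m (mat_ring_F2 n)"
  obtain r :: "bit mat" where r: "r \<in> carrier_mat n n" "r * (r * (r * r)) = r + 1\<^sub>m n"
    "tr (r * (r * r)) = of_nat N"
    using F16_block_matrix_exists[of N] unfolding assms(2) by blast
  have N: "of_nat N = (1 :: bit)" "of_nat n = (0 :: bit)"
    using assms by (auto elim!: oddE)
  define s where "s = r * (r * r)"
  have s: "s \<in> carrier_mat n n" using r by (simp add: s_def mult_carrier_mat[of _ n n _ n])
  have split: "\<exists>u e. u \<in> carrier_mat n n \<and> e \<in> carrier_mat n n \<and>
      u [^]\<^bsub>mat_ring_F2 n\<^esub> m = 1\<^sub>m n \<and> e * e = e \<and> u = x + e"
    if x: "x \<in> carrier_mat n n" for x
  proof -
    obtain u e where ue: "u \<in> carrier_mat n n" "e \<in> carrier_mat n n"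
      "u [^]\<^bsub>mat_ring_F2 n\<^esub> m = 1\<^sub>m n" "e * e = e" "x = u + e"
      using clean x unfolding almost_torsion_clean_def Units_def by (auto simp: ring_mat_simps)
    have "u = u + e + e" by (rule eq_matI) (use ue(1,2) in \<open>auto simp: add.assoc\<close>)
    then have "u = x + e" using ue(5) by simp
    with ue show ?thesis by blast
  qed
  consider "m = 1 \<or> m = 2" | "m = 3" using assms by linarith
  then show False
  proof cases
    case 1
    obtain u e where ue: "u \<in> carrier_mat n n" "e \<in> carrier_mat n n"
      "u [^]\<^bsub>mat_ring_F2 n\<^esub> m = 1\<^sub>m n" "e * e = e" "u = s + e" using split[OF s] by blast
    have "u * u = 1\<^sub>m n"
      using 1
    proof
      assume "m = 1"
      then have "u = 1\<^sub>m n" using ue(3) mat_ring_pow(1)[OF ue(1)] by simp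
      then show ?thesis by simp
    next
      assume "m = 2" then show ?thesis using ue(3) mat_ring_pow(2)[OF ue(1)] by simp
    qed
    then have "tr (s * (s * (s * (s * s)))) = tr s"
      using tr_fifth_of_involution_plus_idempotent[OF s ue(2,4)] ue(5) by simp
    then have "tr (1\<^sub>m n :: bit mat) = tr s"
      unfolding s_def fifth_power_of_cube_F16[OF r(1,2)] .
    then show False using r(3) N by (simp add: tr_one s_def)
  next
    case 2
    obtain u e where ue: "u \<in> carrier_mat n n" "e \<in> carrier_mat n n"
      "u [^]\<^bsub>mat_ring_F2 n\<^esub> m = 1\<^sub>m n" "e * e = e" "u = r + e" using split[OF r(1)] by blast
    have "u * (u * u) = 1\<^sub>m n" using ue(3) 2 mat_ring_pow(3)[OF ue(1)] by simp
    then have "tr (r * (r * r)) = of_nat n"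
      using tr_cube_of_order_3_unit_plus_idempotent[OF r(1) ue(2,4) _ r(2)] ue(5) by simp
    then show False using r(3) N by simp
  qed
qed

theorem theorem2p1:
  shows "(\<forall>n::nat. n \<ge> 1 \<longrightarrow> (\<exists>m\<in>{2, 3, 4}. almost_torsion_clean m (mat_ring_F2 n))) \<and>
    (\<forall>n::nat. (\<exists>k::nat. k \<ge> 1 \<and> n = 4 + 8 * k) \<longrightarrow> torsion_clean 4 (mat_ring_F2 n))"
proof (intro conjI allI impI)
  fix n :: nat
  assume "n \<ge> 1"
  then show "\<exists>m\<in>{2, 3, 4}. almost_torsion_clean m (mat_ring_F2 n)"
    using almost_4_torsion_clean_mat by blast
next
  fix n :: nat
  assume "\<exists>k::nat. k \<ge> 1 \<and> n = 4 + 8 * k"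
  then obtain k where n: "n = 4 * (2 * k + 1)" by auto
  show "torsion_clean 4 (mat_ring_F2 n)"
    unfolding torsion_clean_def
  proof (intro conjI allI impI)
    show "almost_torsion_clean 4 (mat_ring_F2 n)"
      by (rule almost_4_torsion_clean_mat) (simp add: n)
    show "\<not> almost_torsion_clean m (mat_ring_F2 n)" if "0 < m \<and> m < 4" for m
      by (rule not_almost_torsion_clean_below_4[OF _ n]) (use that in simp_all)
  qed
qed

end
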